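(* Let $q$ be a prime power, $n\ge 1$, and let $W$ be the $n$-dimensional projective space over the finite field $\mathbb{F}_q$. Let $A_1,\dots,A_m$ and $B_1,\dots,B_m$ be projective subspaces of $W$ such that $A_i\cap B_i=\emptyset$ for each $1\le i\le m$ and $A_i\cap B_j\neq\emptyset$ whenever $1\le i<j\le m$. Then $$m\le \frac{q^{n+1}-1}{q-1}-1.$$
   Context: The $n$-dimensional projective space over $\mathbb{F}_q$ has as points the $1$-dimensional linear subspaces of $\mathbb{F}_q^{n+1}$; a projective subspace is the set of points contained in some linear subspace of $\mathbb{F}_q^{n+1}$, and intersections of projective subspaces are taken as sets of points. The space has $\frac{q^{n+1}-1}{q-1}$ points.
   Formalization: Projective subspaces are required to be nonempty; with the empty set allowed the claim fails, e.g. n=1, q=2, points x,y,z: (W,∅), ({x},{y}), ({z},{x}), (∅,W) gives m=4 while the bound is 2. *)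

theory Defs
  imports "HOL-Analysis.Cartesian_Space"
begin

text \<open>
  For a type \<open>'n\<close> with \<open>n + 1\<close> elements, \<open>proj_points :: ('a ^ 'n) set set\<close> is the \<open>n\<close>-dimensional
  projective space over the field \<open>'a\<close>; a point is a line through the origin of \<open>'a ^ 'n\<close>.
\<close>

definition proj_points :: "('a::field ^ 'n) set set" where
  "proj_points = {P. vec.subspace P \<and> vec.dim P = 1}"

definition points_in :: "('a::field ^ 'n) set \<Rightarrow> ('a ^ 'n) set set" where
  "points_in U = {P \<in> proj_points. P \<subseteq> U}"

text \<open>
  Projective subspaces are taken to be nonempty, that is, of projective dimension at least 0; the
  zero subspace, which contains no point, is excluded. The convention matters: on the projective
  line over the field with two elements, with points \<open>x, y, z\<close> and point set \<open>W\<close>, the pairs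
  \<open>(W, {})\<close>, \<open>({x}, {y})\<close>, \<open>({z}, {x})\<close>, \<open>({}, W)\<close> form a skew Bollobas system of size 4, whereas
  the bound \<open>(q ^ (n + 1) - 1) / (q - 1) - 1\<close> is 2.
\<close>

definition proj_subspace :: "('a::field ^ 'n) set set \<Rightarrow> bool" where
  "proj_subspace X \<longleftrightarrow> X \<noteq> {} \<and> (\<exists>U. vec.subspace U \<and> X = points_in U)"

end

theory Submission
  imports Defs
begin

text \<open>
  Everything is counted modulo the characteristic, inside the field itself. The number of points of
  a nonempty projective subspace is 1 there, so \<open>A i - B j\<close> has \<open>|A i| - |A i \<inter> B j|\<close> points,
  which is 1 if \<open>i = j\<close> and 0 if \<open>i < j\<close>. Hence the characteristic vectors of the complements
  of the \<open>B j\<close> are linearly independent. Their coordinate sums vanish, so they lie in a hyperplane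
  of the space of functions on the points.
\<close>

text \<open>Summing coordinates over \<open>S i\<close> is a linear functional, and its values on
  the indicator vectors of the \<open>T j\<close> form a triangular matrix with nonzero diagonal.
  The indicators are therefore independent, and they live in a coordinate subspace of dimension
  \<open>card W\<close>.\<close>

lemma card_le_of_triangular_intersections:
  fixes S T :: "nat \<Rightarrow> 'k::finite set" and W :: "'k set"
  assumes W: "\<And>i. i < m \<Longrightarrow> T i \<subseteq> W"
    and diag: "\<And>i. i < m \<Longrightarrow> of_nat (card (S i \<inter> T i)) \<noteq> (0::'a::field)"
    and upper: "\<And>i j. i < j \<Longrightarrow> j < m \<Longrightarrow> of_nat (card (S i \<inter> T j)) = (0::'a)"
  shows "m \<le> card W"
proof -
  define b :: "nat \<Rightarrow> 'a ^ 'k" where "b j = (\<chi> x. if x \<in> T j then 1 else 0)" for j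
  define l :: "nat \<Rightarrow> 'a ^ 'k \<Rightarrow> 'a" where "l i v = (\<Sum>x\<in>S i. v $ x)" for i v
  have l_b: "l i (b j) = of_nat (card (S i \<inter> T j))" for i j
    by (simp add: l_def b_def sum.If_cases)
  have l_span: "l i v = 0" if "v \<in> vec.span X" and "\<And>x. x \<in> X \<Longrightarrow> l i x = 0" for i v X
    using that(1)
  proof (induction rule: vec.span_induct_alt)
    case base
    then show ?case by (simp add: l_def)
  next
    case (step c x y)
    then show ?case using that(2)[of x]
      by (simp add: l_def sum.distrib flip: sum_distrib_left)
  qed
  \<comment> \<open>Vectors are added from the largest index downwards, since \<open>l i\<close>
    kills only the \<open>b j\<close> with \<open>i < j\<close>. The cardinality is carried along
    because independence of an image says nothing about repeated vectors.\<close>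
  have indep: "vec.independent (b ` {m - k..<m}) \<and> card (b ` {m - k..<m}) = k" if "k \<le> m" for k
    using that
  proof (induction k)
    case 0
    then show ?case by (simp add: vec.independent_empty)
  next
    case (Suc k)
    define i where "i = m - Suc k"
    have eq: "{m - Suc k..<m} = insert i {m - k..<m}"
      using Suc.prems by (auto simp: i_def)
    have i: "i < m" "\<And>j. j \<in> {m - k..<m} \<Longrightarrow> i < j \<and> j < m"
      using Suc.prems by (auto simp: i_def)
    have notin: "b i \<notin> vec.span (b ` {m - k..<m})"
    proof
      assume "b i \<in> vec.span (b ` {m - k..<m})"
      then have "l i (b i) = 0"
        by (rule l_span) (use i(2) upper in \<open>auto simp: l_b\<close>)
      then show False
        using diag[OF i(1)] by (simp add: l_b)
    qed
    then have "b i \<notin> b ` {m - k..<m}"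
      using vec.span_base by blast
    with notin Suc show ?case
      by (simp add: eq vec.independent_insert)
  qed
  have "m = card (b ` {..<m})"
    using indep[of m] by (simp add: atLeast0LessThan)
  also have "\<dots> \<le> vec.dim {v :: 'a ^ 'k. \<forall>x. x \<notin> W \<longrightarrow> v $ x = 0}"
  proof (rule vec.independent_card_le_dim)
    show "b ` {..<m} \<subseteq> {v. \<forall>x. x \<notin> W \<longrightarrow> v $ x = 0}"
    proof -
      have "x \<in> W" if "i < m" "x \<in> T i" for i x
        using W[OF that(1)] that(2) by blast
      then show ?thesis
        by (auto simp: b_def)
    qed
    show "vec.independent (b ` {..<m})"
      using indep[of m] by (simp add: atLeast0LessThan)
  qed
  also have "\<dots> = card W"
    by (rule dim_substandard_cart)
  finally show ?thesis .
qed

lemma of_nat_card_field_eq_0: "of_nat CARD('a) = (0::'a::{field,finite})"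
proof -
  have "(\<Sum>x\<in>UNIV. x + (1::'a)) = (\<Sum>x\<in>UNIV. x)"
    by (rule sum.reindex_bij_witness[of _ "\<lambda>x. x - 1" "\<lambda>x. x + 1"]) auto
  then show ?thesis
    by (simp add: sum.distrib)
qed

text \<open>Translation by a nonzero \<open>u \<in> U\<close> permutes \<open>U\<close> but adds \<open>|U| u\<close> to the sum of its elements.\<close>

lemma of_nat_card_subspace_eq_0:
  fixes U :: "('a::{field,finite} ^ 'n::finite) set"
  assumes U: "vec.subspace U" and u: "u \<in> U" "u \<noteq> 0"
  shows "of_nat (card U) = (0::'a)"
proof -
  obtain k where k: "u $ k \<noteq> 0"
    using u(2) by (auto simp: vec_eq_iff)
  have "(\<Sum>x\<in>U. (x + u) $ k) = (\<Sum>x\<in>U. x $ k)"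
    using U u(1)
    by (intro sum.reindex_bij_witness[of _ "\<lambda>x. x - u" "\<lambda>x. x + u"])
      (auto intro: vec.subspace_add vec.subspace_diff)
  then show ?thesis
    using k by (simp add: sum.distrib)
qed

lemma proj_points_iff_line:
  "P \<in> proj_points \<longleftrightarrow> (\<exists>u. u \<noteq> 0 \<and> P = range (\<lambda>c. c *s u))"
proof
  assume P: "P \<in> proj_points"
  then obtain S where S: "S \<subseteq> P" "vec.independent S" "P \<subseteq> vec.span S" "card S = 1"
    using vec.basis_exists[of P] by (auto simp: proj_points_def)
  then obtain u where "S = {u}"
    by (auto simp: card_1_singleton_iff)
  with S P have "u \<noteq> 0" "P = range (\<lambda>c. c *s u)"
    using vec.span_minimal[of S P]
    by (auto simp: vec.dependent_single vec.span_singleton proj_points_def)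
  then show "\<exists>u. u \<noteq> 0 \<and> P = range (\<lambda>c. c *s u)" by blast
next
  assume "\<exists>u. u \<noteq> 0 \<and> P = range (\<lambda>c. c *s u)"
  then obtain u where u: "u \<noteq> 0" "P = vec.span {u}"
    by (auto simp: vec.span_singleton)
  then have "vec.dim P = 1"
    by (simp add: vec.dim_eq_card_independent vec.dependent_single)
  with u show "P \<in> proj_points"
    by (simp add: proj_points_def vec.subspace_span)
qed

text \<open>The points partition the nonzero vectors of \<open>U\<close> into classes of size
  \<open>CARD('a) - 1\<close>. The count serves twice: modulo the characteristic, and over the reals
  for the number of points of the whole space.\<close>

lemma card_points_in:
  fixes U :: "('a::{field,finite} ^ 'n::finite) set"
  assumes U: "vec.subspace U"
  shows "card (points_in U) * (CARD('a) - 1) = card U - 1"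
proof -
  \<comment> \<open>Two points sharing a nonzero vector both equal the line through it, which gives
    disjointness below.\<close>
  have line: "range (\<lambda>c. c *s u) = P" if "P \<in> proj_points" "u \<in> P" "u \<noteq> 0" for P u
  proof -
    obtain v where v: "P = range (\<lambda>c. c *s v)"
      using \<open>P \<in> proj_points\<close> by (auto simp: proj_points_iff_line)
    with that obtain c where c: "u = c *s v" "c \<noteq> 0"
      by auto
    then have "d *s v \<in> range (\<lambda>e. e *s u)" for d
      by (intro range_eqI[of _ _ "d / c"]) simp
    then show ?thesis
      using v c(1) by auto
  qed
  have "card (P - {0}) = CARD('a) - 1" if P: "P \<in> points_in U" for P
  proof -
    obtain u where u: "u \<noteq> 0" "P = range (\<lambda>c. c *s u)"
      using P by (auto simp: points_in_def proj_points_iff_line)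
    moreover have "inj (\<lambda>c. c *s u)"
      using u(1) by (auto intro: injI)
    ultimately have "card P = CARD('a)"
      by (simp add: card_image)
    moreover have "0 \<in> P"
      using u(2) by (auto simp: image_iff intro: exI[of _ 0])
    ultimately show ?thesis by simp
  qed
  then have "card (points_in U) * (CARD('a) - 1) = (\<Sum>P\<in>points_in U. card (P - {0}))"
    by simp
  also have "\<dots> = card (\<Union>P\<in>points_in U. P - {0})"
  proof (rule card_UN_disjoint[symmetric])
    show "\<forall>P\<in>points_in U. \<forall>Q\<in>points_in U. P \<noteq> Q \<longrightarrow> (P - {0}) \<inter> (Q - {0}) = {}"
    proof (intro ballI impI equals0I)
      fix P Q u
      assume "P \<in> points_in U" "Q \<in> points_in U" "P \<noteq> Q" "u \<in> (P - {0}) \<inter> (Q - {0})"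
      then show False
        using line[of P u] line[of Q u] by (simp add: points_in_def)
    qed
  qed simp_all
  also have "(\<Union>P\<in>points_in U. P - {0}) = U - {0}"
  proof (intro equalityI subsetI)
    fix u assume "u \<in> U - {0}"
    then have "range (\<lambda>c. c *s u) \<in> points_in U" "u \<in> range (\<lambda>c. c *s u) - {0}"
      using U by (auto simp: points_in_def proj_points_iff_line vec.subspace_scale
          image_iff intro: exI[of _ 1])
    then show "u \<in> (\<Union>P\<in>points_in U. P - {0})" by blast
  qed (auto simp: points_in_def)
  also have "card (U - {0}) = card U - 1"
    using vec.subspace_0[OF U] by simp
  finally show ?thesis .
qed

text \<open>In the field both \<open>card U\<close> and \<open>CARD('a)\<close> vanish, so
  \<open>card_points_in\<close> becomes \<open>- card X = - 1\<close>. Nonemptiness supplies the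
  nonzero vector that makes \<open>card U\<close> vanish.\<close>

lemma of_nat_card_proj_subspace:
  fixes X :: "('a::{field,finite} ^ 'n::finite) set set"
  assumes "proj_subspace X"
  shows "of_nat (card X) = (1::'a)"
proof -
  obtain U P where U: "vec.subspace U" "X = points_in U" and P: "P \<in> X"
    using assms by (auto simp: proj_subspace_def)
  then obtain u where "u \<noteq> 0" "range (\<lambda>c. c *s u) \<subseteq> U"
    by (auto simp: points_in_def proj_points_iff_line)
  moreover from this have "u \<in> U"
    using rangeI[of "\<lambda>c. c *s u" 1] by auto
  ultimately have card_U: "of_nat (card U) = (0::'a)"
    using of_nat_card_subspace_eq_0[OF U(1)] by blast
  \<comment> \<open>Subtraction of naturals truncates; these bounds let \<open>of_nat\<close> turn
    both differences into differences in the field.\<close>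
  have "card U \<ge> 1"
    using vec.subspace_0[OF U(1)] by (simp add: Suc_le_eq card_gt_0_iff) blast
  moreover have "CARD('a) \<ge> 1"
    by (simp add: Suc_le_eq)
  moreover have "of_nat (card X * (CARD('a) - 1)) = (of_nat (card U - 1) :: 'a)"
    using card_points_in[OF U(1)] U(2) by simp
  ultimately show ?thesis
    by (simp add: of_nat_diff of_nat_card_field_eq_0 card_U del: One_nat_def)
qed

lemma proj_subspace_Int:
  assumes "proj_subspace X" "proj_subspace Y" "X \<inter> Y \<noteq> {}"
  shows "proj_subspace (X \<inter> Y)"
proof -
  obtain U V where UV: "vec.subspace U" "X = points_in U" "vec.subspace V" "Y = points_in V"
    using assms by (auto simp: proj_subspace_def)
  have "vec.subspace (U \<inter> V)" "X \<inter> Y = points_in (U \<inter> V)"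
    using UV by (auto simp: points_in_def vec.subspace_inter)
  with assms(3) show ?thesis
    unfolding proj_subspace_def by blast
qed

lemma proj_subspace_proj_points: "proj_subspace (proj_points :: ('a::field ^ 'n::finite) set set)"
proof -
  have "(1 :: 'a ^ 'n) \<noteq> 0"
    by (simp add: vec_eq_iff)
  then have "range (\<lambda>c. c *s (1 :: 'a ^ 'n)) \<in> proj_points"
    unfolding proj_points_iff_line by blast
  moreover have "proj_points = points_in (UNIV :: ('a ^ 'n) set)"
    by (simp add: points_in_def)
  ultimately show ?thesis
    unfolding proj_subspace_def using vec.subspace_UNIV by blast
qed

theorem theorem3p1:
  fixes A B :: "nat \<Rightarrow> ('a::{field,finite} ^ 'n::finite) set set"
    and q n m :: nat
  assumes "CARD('a) = q"
    and "CARD('n) = n + 1"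
    and "n \<ge> 1"
    and "\<And>i. i \<in> {1..m} \<Longrightarrow> proj_subspace (A i)"
    and "\<And>i. i \<in> {1..m} \<Longrightarrow> proj_subspace (B i)"
    and "\<And>i. i \<in> {1..m} \<Longrightarrow> A i \<inter> B i = {}"
    and "\<And>i j. 1 \<le> i \<Longrightarrow> i < j \<Longrightarrow> j \<le> m \<Longrightarrow> A i \<inter> B j \<noteq> {}"
  shows "real m \<le> (real q ^ (n + 1) - 1) / (real q - 1) - 1"
proof -
  let ?W = "proj_points :: ('a ^ 'n) set set"
  have W: "proj_subspace ?W"
    by (rule proj_subspace_proj_points)
  then obtain P where P: "P \<in> ?W"
    by (auto simp: proj_subspace_def)
  have sub: "X \<subseteq> ?W" if "proj_subspace X" for X
    using that by (auto simp: proj_subspace_def points_in_def)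
  \<comment> \<open>The extra index 0 accounts for the hyperplane: the functional summing all coordinates
    kills every other vector, but not the unit vector at \<open>P\<close>.\<close>
  define S where "S i = (if i = 0 then ?W else A i)" for i
  define T where "T j = (if j = 0 then {P} else ?W - B j)" for j
  have S: "proj_subspace (S i)" if "i \<le> m" for i
    using W assms(4) that by (simp add: S_def)
  have card_ST: "of_nat (card (S i \<inter> T j)) = 1 - (of_nat (card (S i \<inter> B j)) :: 'a)"
    if "i \<le> m" "1 \<le> j" for i j
  proof -
    have "S i \<inter> T j = S i - S i \<inter> B j"
      using that sub[OF S] by (auto simp: T_def)
    then have "card (S i \<inter> T j) = card (S i) - card (S i \<inter> B j)"
      by (simp add: card_Diff_subset)
    moreover have "card (S i \<inter> B j) \<le> card (S i)"
      by (simp add: card_mono)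
    ultimately show ?thesis
      using of_nat_card_proj_subspace[OF S[OF that(1)]] by (simp add: of_nat_diff)
  qed
  \<comment> \<open>The indices run over 0, ..., \<open>m\<close>; the additional one produces the
    final \<open>- 1\<close> of the bound.\<close>
  have "m + 1 \<le> card ?W"
  proof (rule card_le_of_triangular_intersections[where S = S and T = T and 'a = 'a])
    show "T i \<subseteq> ?W" for i
      using P by (auto simp: T_def)
    show "of_nat (card (S i \<inter> T i)) \<noteq> (0::'a)" if "i < m + 1" for i
    proof (cases "i = 0")
      case True
      with P show ?thesis by (simp add: S_def T_def)
    next
      case False
      with that assms(6)[of i] card_ST[of i i] show ?thesis by (simp add: S_def)
    qed
    show "of_nat (card (S i \<inter> T j)) = (0::'a)" if "i < j" "j < m + 1" for i j
    proof -
      have B: "proj_subspace (B j)"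
        using assms(5) that by simp
      \<comment> \<open>For \<open>i = 0\<close> the intersection is \<open>B j\<close> itself, so
        the convention that projective subspaces are nonempty enters here.\<close>
      have "S i \<inter> B j \<noteq> {}"
      proof (cases "i = 0")
        case True
        with B sub[OF B] show ?thesis by (auto simp: S_def proj_subspace_def)
      next
        case False
        with assms(7)[of i j] that show ?thesis by (simp add: S_def)
      qed
      then have "proj_subspace (S i \<inter> B j)"
        using S B that by (intro proj_subspace_Int) auto
      then have "of_nat (card (S i \<inter> B j)) = (1::'a)"
        by (rule of_nat_card_proj_subspace)
      with card_ST[of i j] that show ?thesis
        by simp
    qed
  qed
  moreover have "real (card ?W) * (real q - 1) = real q ^ (n + 1) - 1"
  proof -
    have "card ?W * (q - 1) = q ^ (n + 1) - 1"
      using card_points_in[OF vec.subspace_UNIV, where 'a = 'a and 'n = 'n] assms(1,2)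
      by (simp add: points_in_def)
    then have "real (card ?W * (q - 1)) = real (q ^ (n + 1) - 1)"
      by (rule arg_cong)
    moreover have "q \<ge> 1"
      using assms(1) by (auto simp: Suc_le_eq)
    ultimately show ?thesis
      by simp
  qed
  \<comment> \<open>A field has 0 and 1 distinct, so the denominator \<open>real q - 1\<close> is
    nonzero.\<close>
  moreover have "q > 1"
    using assms(1) card_mono[of UNIV "{0, 1::'a}"] by simp
  ultimately have "(real q ^ (n + 1) - 1) / (real q - 1) = real (card ?W)" "real m + 1 \<le> real (card ?W)"
    by (simp_all add: divide_eq_eq)
  then show ?thesis
    by linarith
qed

end
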